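(* Let $K\subset\mathbb{R}^d$ ($d\geq 1$) be a closed convex cone with non-empty interior, and let $\mu$ be a probability measure on $\mathbb{R}^d$ such that: (i) the support of $\mu$ is not included in any linear hyperplane of $\mathbb{R}^d$; (ii) there exist a point $x^*\in K^*$ and an open neighborhood $V$ of $x^*$ in $\mathbb{R}^d$ such that $L_\mu(x)<\infty$ for all $x\in V$, and $x^*$ is a minimum point of $L_\mu$ restricted to $K^*\cap V$. Then $L_\mu(x^* )=1$ if and only if $x^*=0$. In addition, if $\mu$ admits a moment of order $1$, so that the drift $m=\int_{\mathbb{R}^d}y\,\mu(dy)$ exists, then $m\in K$ if and only if $x^*=0$.
   Context: $\langle\cdot,\cdot\rangle$ is the standard inner product on $\mathbb{R}^d$. The dual cone of $K$ is $K^*=\{z\in\mathbb{R}^d:\langle x,z\rangle\geq 0\ \forall x\in K\}$. The Laplace transform of $\mu$ is $L_\mu(x)=\int_{\mathbb{R}^d}e^{\langle x,y\rangle}\mu(dy)\in(0,\infty]$. *)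

theory Defs
  imports "HOL-Probability.Probability"
begin

definition dual_cone :: "'a::real_inner set \<Rightarrow> 'a set"
  where "dual_cone K = {z. \<forall>x\<in>K. x \<bullet> z \<ge> 0}"

(* Valued in the extended nonnegative reals: the integral may be infinite. *)
definition laplace_transform :: "'a::euclidean_space measure \<Rightarrow> 'a \<Rightarrow> ennreal"
  where "laplace_transform \<mu> x = (\<integral>\<^sup>+ y. ennreal (exp (x \<bullet> y)) \<partial>\<mu>)"

(* Topological support; on a Euclidean space (second countable) it is the least closed set
   whose complement is null. *)
definition measure_support :: "'a::topological_space measure \<Rightarrow> 'a set"
  where "measure_support \<mu> = {x. \<forall>U. open U \<longrightarrow> x \<in> U \<longrightarrow> emeasure \<mu> U > 0}"

(* Hyperplanes through the origin only, not affine ones. *)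
definition linear_hyperplane :: "'a::real_inner set \<Rightarrow> bool"
  where "linear_hyperplane H \<longleftrightarrow> (\<exists>a. a \<noteq> 0 \<and> H = {y. a \<bullet> y = 0})"

definition has_first_moment :: "'a::euclidean_space measure \<Rightarrow> bool"
  where "has_first_moment \<mu> \<longleftrightarrow> integrable \<mu> (\<lambda>y. norm y)"

(* Meaningful only under has_first_moment; the Bochner integral is 0 otherwise. *)
definition drift :: "'a::euclidean_space measure \<Rightarrow> 'a"
  where "drift \<mu> = (\<integral>y. y \<partial>\<mu>)"

end

theory Submission
  imports Defs
begin

text \<open>
  Fix a direction \<open>z\<close> in the dual cone and look at \<open>t \<mapsto> L (t z) = \<integral> exp (t (z \<bullet> y)) \<partial>\<mu>\<close> on the ray
  through \<open>z\<close>. This function is convex, has value 1 and (when the mean \<open>m\<close> exists) slope \<open>z \<bullet> m\<close>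
  at 0, and it is strictly convex as soon as \<open>z \<bullet> y\<close> is not almost surely zero, which is what the
  hypothesis on the support guarantees for every \<open>z \<noteq> 0\<close>.

  Suppose that the minimum point \<open>z\<close> is not 0. If \<open>L z = 1 = L 0\<close>, then strict convexity forces
  \<open>L (t z) < L z\<close> for \<open>0 < t < 1\<close>. If \<open>m \<in> K\<close>, then the slope \<open>z \<bullet> m\<close> at 0 is nonnegative, so
  \<open>L\<close> strictly increases from 0 to \<open>z\<close>, and again \<open>L (t z) < L z\<close>. Since \<open>t z\<close> stays in the cone
  and, for \<open>t\<close> close to 1, in \<open>V\<close>, both contradict minimality
  (\<open>laplace_less_of_value_one\<close>, \<open>laplace_less_of_nonneg_mean\<close>).

  Suppose that the minimum point is 0. Then the slope at 0 is nonnegative in every direction of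
  the dual cone (\<open>nonneg_mean_of_laplace_ge_1\<close>), so \<open>m\<close> lies in the bidual cone, which is \<open>K\<close>
  because \<open>K\<close> is a closed convex cone (\<open>in_closed_convex_cone_if_dual_nonneg\<close>).
\<close>

section \<open>Elementary inequalities for the exponential\<close>

lemma exp_gt_one_plus:
  fixes u :: real
  assumes "u \<noteq> 0"
  shows "1 + u < exp u"
proof -
  have "exp u \<noteq> 1 + u"
    using ln_eq_minus_one[of "exp u"] assms by auto
  with exp_ge_add_one_self[of u] show ?thesis by linarith
qed

text \<open>Strict convexity of \<open>exp\<close> between 0 and \<open>s\<close>: average the tangent line at \<open>t * s\<close> over the
  two end points.\<close>

lemma exp_mult_less_chord:
  fixes s t :: real
  assumes "0 < t" "t < 1" "s \<noteq> 0"
  shows "exp (t * s) < t * exp s + (1 - t)"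
proof -
  define c where "c = exp (t * s)"
  have c: "c > 0" by (simp add: c_def)
  have "exp s = c * exp ((1 - t) * s)"
    by (simp add: c_def flip: exp_add) (simp add: algebra_simps)
  moreover have "1 + (1 - t) * s < exp ((1 - t) * s)"
    using assms by (intro exp_gt_one_plus) auto
  ultimately have 1: "c * (1 + (1 - t) * s) < exp s"
    using c by simp
  have "1 = c * exp (- (t * s))"
    by (simp add: c_def flip: exp_add)
  moreover have "1 + - (t * s) < exp (- (t * s))"
    using assms by (intro exp_gt_one_plus) auto
  ultimately have 2: "c * (1 + - (t * s)) < 1"
    using c by (metis mult_strict_left_mono)
  have "c = t * (c * (1 + (1 - t) * s)) + (1 - t) * (c * (1 + - (t * s)))"
    by (simp add: algebra_simps)
  also have "\<dots> < t * exp s + (1 - t) * 1"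
    using 1 2 assms by (intro add_strict_mono mult_strict_left_mono) auto
  finally show ?thesis by (simp add: c_def)
qed

lemma exp_mult_le_chord:
  fixes s t :: real
  assumes "0 < t" "t < 1"
  shows "exp (t * s) \<le> t * exp s + (1 - t)"
  using exp_mult_less_chord[OF assms, of s] by (cases "s = 0") auto

text \<open>The increment over \<open>[t * s, s]\<close> exceeds what the slope of \<open>exp\<close> at 0 predicts, because
  \<open>s * exp (t * s) > s\<close> for either sign of \<open>s\<close>.\<close>

lemma exp_increment_gt:
  fixes s t :: real
  assumes "0 < t" "t < 1" "s \<noteq> 0"
  shows "exp (t * s) + (1 - t) * s < exp s"
proof -
  define c where "c = exp (t * s)"
  have c: "c > 0" by (simp add: c_def)
  have "exp s = c * exp ((1 - t) * s)"
    by (simp add: c_def flip: exp_add) (simp add: algebra_simps)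
  with c have 1: "c * (1 + (1 - t) * s) \<le> exp s"
    using exp_ge_add_one_self[of "(1 - t) * s"] by simp
  have "s < s * c"
    using assms by (cases "s > 0") (auto simp: c_def mult_less_0_iff mult_pos_neg)
  then have "(1 - t) * s < (1 - t) * (s * c)"
    using assms by simp
  with 1 show ?thesis by (simp add: c_def algebra_simps)
qed

lemma exp_increment_ge:
  fixes s t :: real
  assumes "0 < t" "t < 1"
  shows "exp (t * s) + (1 - t) * s \<le> exp s"
  using exp_increment_gt[OF assms, of s] by (cases "s = 0") auto

text \<open>Difference quotients of \<open>exp\<close> at 0 lie between the derivative and the quotient at 1; this
  is what dominates them uniformly in the passage to the limit under the integral.\<close>

lemma exp_quotient_bounds:
  fixes s t :: real
  assumes "0 < t" "t \<le> 1"
  shows "s \<le> (exp (t * s) - 1) / t" "(exp (t * s) - 1) / t \<le> exp s - 1"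
proof -
  show "s \<le> (exp (t * s) - 1) / t"
    using assms exp_ge_add_one_self[of "t * s"] by (simp add: field_simps)
  have "exp (t * s) \<le> t * exp s + (1 - t)"
    using exp_mult_le_chord[of t s] assms by (cases "t = 1") auto
  then show "(exp (t * s) - 1) / t \<le> exp s - 1"
    using assms by (simp add: field_simps)
qed

lemma exp_quotient_tendsto:
  fixes s :: real
  shows "(\<lambda>n. (exp (inverse (real (Suc n)) * s) - 1) / inverse (real (Suc n))) \<longlonglongrightarrow> s"
proof -
  have "((\<lambda>t. exp (t * s)) has_real_derivative s) (at 0)"
    by (auto intro!: derivative_eq_intros)
  then have "((\<lambda>t. (exp (t * s) - 1) / t) \<longlongrightarrow> s) (at 0)"
    by (simp add: has_field_derivative_iff)
  moreover have "filterlim (\<lambda>n. inverse (real (Suc n))) (at 0) sequentially"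
    using LIMSEQ_inverse_real_of_nat by (auto simp: filterlim_at)
  ultimately show ?thesis
    by (rule filterlim_compose)
qed

section \<open>Closed convex cones and their duals\<close>

text \<open>The bidual cone of a closed convex cone is contained in it: a hyperplane strictly separating
  \<open>m\<close> from the cone has, by homogeneity, a normal vector in the dual cone that is negative at
  \<open>m\<close>.\<close>

lemma in_closed_convex_cone_if_dual_nonneg:
  fixes K :: "'a::euclidean_space set"
  assumes "closed K" "convex_cone K" and nonneg: "\<And>z. z \<in> dual_cone K \<Longrightarrow> 0 \<le> m \<bullet> z"
  shows "m \<in> K"
proof (rule ccontr)
  assume "m \<notin> K"
  moreover have "convex K" "cone K" "K \<noteq> {}"
    using \<open>convex_cone K\<close> by (auto simp: convex_cone_def conic_def cone_def)
  ultimately obtain a b where a: "a \<bullet> m < b" "\<forall>x\<in>K. b < a \<bullet> x"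
    using separating_hyperplane_closed_point \<open>closed K\<close> by blast
  have "0 \<in> K"
    using \<open>cone K\<close> \<open>K \<noteq> {}\<close> cone_contains_0 by blast
  with a have "b < 0" by fastforce
  have "0 \<le> x \<bullet> a" if "x \<in> K" for x
  proof (rule ccontr)
    assume "\<not> 0 \<le> x \<bullet> a"
    then have neg: "a \<bullet> x < 0" by (simp add: inner_commute)
    \<comment> \<open>the multiple of \<open>x\<close> that lies on the separating hyperplane\<close>
    define c where "c = b / (a \<bullet> x)"
    have "0 \<le> c" using neg \<open>b < 0\<close> by (simp add: c_def divide_nonpos_neg)
    then have "c *\<^sub>R x \<in> K"
      using \<open>cone K\<close> that by (simp add: cone_def)
    moreover have "a \<bullet> (c *\<^sub>R x) = b"
      using neg by (simp add: c_def)
    ultimately show False using a by fastforce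
  qed
  then have "a \<in> dual_cone K" by (simp add: dual_cone_def)
  from nonneg[OF this] a \<open>b < 0\<close> show False
    by (simp add: inner_commute)
qed

lemma scaleR_in_dual_cone:
  assumes "z \<in> dual_cone K" "0 \<le> t"
  shows "t *\<^sub>R z \<in> dual_cone K"
  using assms by (auto simp: dual_cone_def)

section \<open>The Laplace transform along a ray\<close>

lemma emeasure_off_orthogonal_nonzero:
  fixes a :: "'a::euclidean_space"
  assumes "\<not> (\<exists>H. linear_hyperplane H \<and> measure_support \<mu> \<subseteq> H)" "a \<noteq> 0"
  shows "emeasure \<mu> {y. a \<bullet> y \<noteq> 0} \<noteq> 0"
proof
  assume null: "emeasure \<mu> {y. a \<bullet> y \<noteq> 0} = 0"
  have "open {y. a \<bullet> y \<noteq> 0}"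
    by (intro open_Collect_neq continuous_intros)
  with null have "measure_support \<mu> \<subseteq> {y. a \<bullet> y = 0}"
    by (force simp: measure_support_def)
  moreover have "linear_hyperplane {y. a \<bullet> y = 0}"
    using \<open>a \<noteq> 0\<close> by (auto simp: linear_hyperplane_def)
  ultimately show False using assms(1) by blast
qed

context
  fixes \<mu> :: "'a::euclidean_space measure"
  assumes prob: "prob_space \<mu>" and borel: "sets \<mu> = sets borel"
begin

lemma borel_measurable_exp_inner: "(\<lambda>y. exp (x \<bullet> y)) \<in> borel_measurable \<mu>"
proof -
  have "(\<lambda>y. exp (x \<bullet> y)) \<in> borel_measurable borel"
    by (intro borel_measurable_continuous_onI continuous_intros)
  then show ?thesis
    using borel measurable_cong_sets by blast
qed

lemma integrable_exp_inner:
  assumes "laplace_transform \<mu> x < \<infinity>"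
  shows "integrable \<mu> (\<lambda>y. exp (x \<bullet> y))"
  using assms borel_measurable_exp_inner[of x]
  by (intro integrableI_nonneg) (auto simp: laplace_transform_def)

lemma laplace_transform_eq_integral:
  assumes "integrable \<mu> (\<lambda>y. exp (x \<bullet> y))"
  shows "laplace_transform \<mu> x = ennreal (\<integral>y. exp (x \<bullet> y) \<partial>\<mu>)"
  unfolding laplace_transform_def using assms by (intro nn_integral_eq_integral) auto

lemma laplace_transform_0: "laplace_transform \<mu> 0 = 1"
  using prob prob_space.emeasure_space_1 by (auto simp: laplace_transform_def)

text \<open>Finiteness passes to segments with end point 0, since \<open>L 0 = 1\<close> and \<open>L\<close> is convex.\<close>

lemma integrable_exp_inner_scaleR:
  assumes "integrable \<mu> (\<lambda>y. exp (z \<bullet> y))" "0 < t" "t < 1"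
  shows "integrable \<mu> (\<lambda>y. exp ((t *\<^sub>R z) \<bullet> y))"
proof (rule Bochner_Integration.integrable_bound)
  interpret prob_space \<mu> by (rule prob)
  show "integrable \<mu> (\<lambda>y. t * exp (z \<bullet> y) + (1 - t))"
    using assms by simp
  show "(\<lambda>y. exp ((t *\<^sub>R z) \<bullet> y)) \<in> borel_measurable \<mu>"
    by (rule borel_measurable_exp_inner)
  show "AE y in \<mu>. norm (exp ((t *\<^sub>R z) \<bullet> y)) \<le> norm (t * exp (z \<bullet> y) + (1 - t))"
  proof (rule AE_I2)
    fix y
    have "exp (t * (z \<bullet> y)) \<le> t * exp (z \<bullet> y) + (1 - t)"
      using assms by (intro exp_mult_le_chord)
    then show "norm (exp ((t *\<^sub>R z) \<bullet> y)) \<le> norm (t * exp (z \<bullet> y) + (1 - t))"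
      by simp
  qed
qed

lemma off_orthogonal_in_sets: "{y. z \<bullet> y \<noteq> 0} \<in> sets \<mu>"
  unfolding borel by (intro borel_open open_Collect_neq continuous_intros)

text \<open>If \<open>L\<close> takes the value 1 at both ends of the segment from 0 to \<open>z\<close>, it is below 1 in
  between.\<close>

lemma laplace_less_of_value_one:
  assumes int: "integrable \<mu> (\<lambda>y. exp (z \<bullet> y))" and t: "0 < t" "t < 1"
    and nz: "emeasure \<mu> {y. z \<bullet> y \<noteq> 0} \<noteq> 0" and one: "laplace_transform \<mu> z = 1"
  shows "laplace_transform \<mu> (t *\<^sub>R z) < laplace_transform \<mu> z"
proof -
  interpret prob_space \<mu> by (rule prob)
  note int_t = integrable_exp_inner_scaleR[OF int t]
  have val: "(\<integral>y. exp (z \<bullet> y) \<partial>\<mu>) = 1"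
    using one laplace_transform_eq_integral[OF int] by simp
  have "(\<integral>y. exp ((t *\<^sub>R z) \<bullet> y) \<partial>\<mu>) < (\<integral>y. t * exp (z \<bullet> y) + (1 - t) \<partial>\<mu>)"
  proof (rule integral_less_AE[OF int_t _ nz off_orthogonal_in_sets])
    show "integrable \<mu> (\<lambda>y. t * exp (z \<bullet> y) + (1 - t))"
      using int by simp
    show "AE y in \<mu>. y \<in> {y. z \<bullet> y \<noteq> 0} \<longrightarrow> exp ((t *\<^sub>R z) \<bullet> y) \<noteq> t * exp (z \<bullet> y) + (1 - t)"
      using exp_mult_less_chord[OF t] by (intro AE_I2) (auto simp: less_imp_neq)
    show "AE y in \<mu>. exp ((t *\<^sub>R z) \<bullet> y) \<le> t * exp (z \<bullet> y) + (1 - t)"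
      using exp_mult_le_chord[OF t] by (intro AE_I2) simp
  qed
  also have "\<dots> = 1"
    using int val by (simp add: prob_space)
  finally show ?thesis
    unfolding laplace_transform_eq_integral[OF int_t] laplace_transform_eq_integral[OF int] val
    by (simp add: ennreal_less_iff)
qed

lemma integrable_inner_of_first_moment:
  assumes "has_first_moment \<mu>"
  shows "integrable \<mu> (\<lambda>y. z \<bullet> y)" "(\<integral>y. z \<bullet> y \<partial>\<mu>) = drift \<mu> \<bullet> z"
proof -
  have "(\<lambda>y. y) \<in> borel_measurable \<mu>"
    using measurable_ident_sets[OF borel] by simp
  then have int: "integrable \<mu> (\<lambda>y. y)"
    using assms by (simp add: has_first_moment_def integrable_norm_iff)
  then show "integrable \<mu> (\<lambda>y. z \<bullet> y)" by simp
  show "(\<integral>y. z \<bullet> y \<partial>\<mu>) = drift \<mu> \<bullet> z"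
    using int by (simp add: drift_def inner_commute)
qed

text \<open>If \<open>L\<close> has nonnegative slope at 0 in direction \<open>z\<close>, strict convexity makes it strictly
  increasing along the segment from 0 to \<open>z\<close>.\<close>

lemma laplace_less_of_nonneg_mean:
  assumes int: "integrable \<mu> (\<lambda>y. exp (z \<bullet> y))" and t: "0 < t" "t < 1"
    and nz: "emeasure \<mu> {y. z \<bullet> y \<noteq> 0} \<noteq> 0"
    and mom: "has_first_moment \<mu>" and mean: "0 \<le> drift \<mu> \<bullet> z"
  shows "laplace_transform \<mu> (t *\<^sub>R z) < laplace_transform \<mu> z"
proof -
  interpret prob_space \<mu> by (rule prob)
  note int_t = integrable_exp_inner_scaleR[OF int t]
  note int_s = integrable_inner_of_first_moment[OF mom, of z]
  have "(\<integral>y. exp ((t *\<^sub>R z) \<bullet> y) \<partial>\<mu>) \<le> (\<integral>y. exp ((t *\<^sub>R z) \<bullet> y) \<partial>\<mu>) + (1 - t) * (drift \<mu> \<bullet> z)"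
    using t mean by simp
  also have "\<dots> = (\<integral>y. exp ((t *\<^sub>R z) \<bullet> y) + (1 - t) * (z \<bullet> y) \<partial>\<mu>)"
    using Bochner_Integration.integral_add[OF int_t integrable_mult_right[OF int_s(1), of "1 - t"]]
      int_s(2) by simp
  also have "\<dots> < (\<integral>y. exp (z \<bullet> y) \<partial>\<mu>)"
  proof (rule integral_less_AE[OF _ int nz off_orthogonal_in_sets])
    show "integrable \<mu> (\<lambda>y. exp ((t *\<^sub>R z) \<bullet> y) + (1 - t) * (z \<bullet> y))"
      using int_t int_s(1) by (intro Bochner_Integration.integrable_add integrable_mult_right)
    show "AE y in \<mu>. y \<in> {y. z \<bullet> y \<noteq> 0} \<longrightarrow> exp ((t *\<^sub>R z) \<bullet> y) + (1 - t) * (z \<bullet> y) \<noteq> exp (z \<bullet> y)"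
      using exp_increment_gt[OF t] by (intro AE_I2) (auto simp: less_imp_neq)
    show "AE y in \<mu>. exp ((t *\<^sub>R z) \<bullet> y) + (1 - t) * (z \<bullet> y) \<le> exp (z \<bullet> y)"
      using exp_increment_ge[OF t] by (intro AE_I2) simp
  qed
  finally show ?thesis
    unfolding laplace_transform_eq_integral[OF int_t] laplace_transform_eq_integral[OF int]
    by (simp add: ennreal_less_iff)
qed

text \<open>Conversely, if \<open>L\<close> never drops below \<open>L 0 = 1\<close> on the segment from 0 to \<open>z\<close>, its difference
  quotients at 0 are nonnegative; they converge to the slope \<open>drift \<mu> \<bullet> z\<close> by dominated
  convergence.\<close>

lemma nonneg_mean_of_laplace_ge_1:
  assumes int: "integrable \<mu> (\<lambda>y. exp (z \<bullet> y))" and mom: "has_first_moment \<mu>"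
    and ge: "\<And>t. 0 < t \<Longrightarrow> t \<le> 1 \<Longrightarrow> 1 \<le> laplace_transform \<mu> (t *\<^sub>R z)"
  shows "0 \<le> drift \<mu> \<bullet> z"
proof -
  interpret prob_space \<mu> by (rule prob)
  note int_s = integrable_inner_of_first_moment[OF mom, of z]
  define t where "t n = inverse (real (Suc n))" for n
  have t: "0 < t n" "t n \<le> 1" for n
    by (auto simp: t_def inverse_le_1_iff)
  define q where "q n y = (exp (t n * (z \<bullet> y)) - 1) / t n" for n y
  have int_t: "integrable \<mu> (\<lambda>y. exp ((t n *\<^sub>R z) \<bullet> y))" for n
    using int integrable_exp_inner_scaleR[OF int, of "t n"] t[of n] by (cases "t n = 1") auto
  have int_q: "integrable \<mu> (q n)" for n
    unfolding q_def using int_t[of n] by simp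
  have q_nonneg: "0 \<le> (\<integral>y. q n y \<partial>\<mu>)" for n
  proof -
    have "1 \<le> (\<integral>y. exp ((t n *\<^sub>R z) \<bullet> y) \<partial>\<mu>)"
      using ge[OF t, of n] laplace_transform_eq_integral[OF int_t[of n]]
      by (metis ennreal_1 ennreal_le_iff2 not_one_le_zero)
    moreover have "(\<integral>y. q n y \<partial>\<mu>) = ((\<integral>y. exp ((t n *\<^sub>R z) \<bullet> y) \<partial>\<mu>) - 1) / t n"
      unfolding q_def using int_t[of n] by (simp add: prob_space)
    ultimately show ?thesis using t[of n] by simp
  qed
  have "(\<lambda>n. \<integral>y. q n y \<partial>\<mu>) \<longlonglongrightarrow> (\<integral>y. z \<bullet> y \<partial>\<mu>)"
  proof (rule integral_dominated_convergence)
    show "integrable \<mu> (\<lambda>y. \<bar>z \<bullet> y\<bar> + \<bar>exp (z \<bullet> y) - 1\<bar>)"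
      using int int_s(1) by simp
    show "AE y in \<mu>. (\<lambda>n. q n y) \<longlonglongrightarrow> z \<bullet> y"
      unfolding q_def t_def by (intro AE_I2 exp_quotient_tendsto)
    show "AE y in \<mu>. norm (q n y) \<le> \<bar>z \<bullet> y\<bar> + \<bar>exp (z \<bullet> y) - 1\<bar>" for n
    proof (rule AE_I2)
      fix y
      show "norm (q n y) \<le> \<bar>z \<bullet> y\<bar> + \<bar>exp (z \<bullet> y) - 1\<bar>"
        using exp_quotient_bounds[OF t[of n], of "z \<bullet> y"] unfolding q_def real_norm_def
        by linarith
    qed
  qed (use int_s(1) int_q in auto)
  then have "0 \<le> (\<integral>y. z \<bullet> y \<partial>\<mu>)"
    by (rule LIMSEQ_le_const) (use q_nonneg in auto)
  with int_s(2) show ?thesis by simp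
qed

end

section \<open>Characterisation of the minimum point\<close>

text \<open>Such a \<open>t *\<^sub>R z\<close> is the competitor that refutes minimality at a nonzero \<open>z\<close>.\<close>

lemma open_contains_shrunk:
  fixes z :: "'a::real_normed_vector"
  assumes "open V" "z \<in> V"
  obtains t :: real where "0 < t" "t < 1" "t *\<^sub>R z \<in> V"
proof -
  have "((\<lambda>t. t *\<^sub>R z) \<longlongrightarrow> 1 *\<^sub>R z) (at_left (1::real))"
    by (intro tendsto_intros)
  with assms have "\<forall>\<^sub>F t in at_left (1::real). t *\<^sub>R z \<in> V"
    by (intro topological_tendstoD) auto
  moreover have "\<forall>\<^sub>F t in at_left (1::real). t \<in> {0<..<1}"
    by (intro eventually_at_left_real) auto
  ultimately have "\<forall>\<^sub>F t in at_left (1::real). t *\<^sub>R z \<in> V \<and> t \<in> {0<..<1}"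
    by (rule eventually_conj)
  then obtain t :: real where "t *\<^sub>R z \<in> V" "t \<in> {0<..<1}"
    using eventually_happens' trivial_limit_at_left_real by blast
  with that show thesis by auto
qed

theorem lemma2:
  fixes K V :: "(real ^ 'd) set" and \<mu> :: "(real ^ 'd) measure" and xs :: "real ^ 'd"
  assumes "closed K" and "convex_cone K" and "interior K \<noteq> {}"
    and "prob_space \<mu>" and "sets \<mu> = sets borel"
    and "\<not> (\<exists>H. linear_hyperplane H \<and> measure_support \<mu> \<subseteq> H)"
    and "xs \<in> dual_cone K" and "open V" and "xs \<in> V"
    and "\<forall>x\<in>V. laplace_transform \<mu> x < \<infinity>"
    and "is_arg_min (laplace_transform \<mu>) (\<lambda>x. x \<in> dual_cone K \<inter> V) xs"
  shows "(laplace_transform \<mu> xs = 1 \<longleftrightarrow> xs = 0)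
    \<and> (has_first_moment \<mu> \<longrightarrow> (drift \<mu> \<in> K \<longleftrightarrow> xs = 0))"
proof -
  note prob = assms(4) and borel = assms(5)
  have int: "integrable \<mu> (\<lambda>y. exp (x \<bullet> y))" if "x \<in> V" for x
    using integrable_exp_inner[OF prob borel] assms(10) that by blast
  have minimal: "\<not> laplace_transform \<mu> x < laplace_transform \<mu> xs"
    if "x \<in> dual_cone K" "x \<in> V" for x
    using assms(11) that by (auto simp: is_arg_min_def)
  obtain t :: real where t: "0 < t" "t < 1" "t *\<^sub>R xs \<in> V"
    using open_contains_shrunk[OF assms(8,9)] .
  have no_descent: "\<not> laplace_transform \<mu> (t *\<^sub>R xs) < laplace_transform \<mu> xs"
    using minimal t scaleR_in_dual_cone[OF assms(7)] by simp
  have nz: "emeasure \<mu> {y. xs \<bullet> y \<noteq> 0} \<noteq> 0" if "xs \<noteq> 0"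
    using emeasure_off_orthogonal_nonzero[OF assms(6) that] .
  have at_min: "laplace_transform \<mu> xs = 1 \<longleftrightarrow> xs = 0"
    using no_descent laplace_less_of_value_one[OF prob borel int[OF assms(9)] t(1,2) nz]
      laplace_transform_0[OF prob borel] by blast
  have drift: "drift \<mu> \<in> K \<longleftrightarrow> xs = 0" if mom: "has_first_moment \<mu>"
  proof
    assume "drift \<mu> \<in> K"
    then have "0 \<le> drift \<mu> \<bullet> xs"
      using assms(7) by (simp add: dual_cone_def)
    then show "xs = 0"
      using no_descent laplace_less_of_nonneg_mean[OF prob borel int[OF assms(9)] t(1,2) nz mom]
      by blast
  next
    assume "xs = 0"
    show "drift \<mu> \<in> K"
    proof (rule in_closed_convex_cone_if_dual_nonneg[OF assms(1,2)])
      fix z assume z: "z \<in> dual_cone K"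
      obtain e where e: "0 < e" "ball 0 e \<subseteq> V"
        using assms(8,9) \<open>xs = 0\<close> open_contains_ball by blast
      \<comment> \<open>shrink \<open>z\<close> so that its whole segment to 0 lies in \<open>V\<close>\<close>
      define r where "r = e / (1 + norm z)"
      have r: "0 < r" using e by (simp add: r_def add_pos_nonneg)
      have "norm (r *\<^sub>R z) < e"
        using e by (simp add: r_def divide_simps add_pos_nonneg)
      have in_V: "s *\<^sub>R r *\<^sub>R z \<in> V" if "0 < s" "s \<le> 1" for s
      proof -
        have "norm (s *\<^sub>R r *\<^sub>R z) = s * norm (r *\<^sub>R z)"
          using that by (simp add: abs_mult)
        also have "\<dots> \<le> norm (r *\<^sub>R z)"
          using that by (intro mult_left_le_one_le) auto
        also note \<open>norm (r *\<^sub>R z) < e\<close>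
        finally show ?thesis using e by auto
      qed
      have "0 \<le> drift \<mu> \<bullet> (r *\<^sub>R z)"
      proof (rule nonneg_mean_of_laplace_ge_1[OF prob borel _ mom])
        show "integrable \<mu> (\<lambda>y. exp ((r *\<^sub>R z) \<bullet> y))"
          using int[OF in_V[of 1]] by simp
        show "1 \<le> laplace_transform \<mu> (s *\<^sub>R r *\<^sub>R z)" if "0 < s" "s \<le> 1" for s
          using minimal[OF _ in_V[OF that]] scaleR_in_dual_cone[OF z, of "s * r"] that r
            laplace_transform_0[OF prob borel] \<open>xs = 0\<close> by (simp add: not_less)
      qed
      with r show "0 \<le> drift \<mu> \<bullet> z"
        by (simp add: zero_le_mult_iff)
    qed
  qed
  from at_min drift show ?thesis by blast
qed

end
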